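(* Let $G=(X,E)$ be a connected graph of finite geometry and let $P$ be a probability kernel on $X$ with $P(x,y)>0\iff x\sim y$, for which there exist a probability kernel $\widehat P:X\times X\to[0,1]$ and a measure $\mu:X\to(0,\infty)$ with $\mu(x)P(x,y)=\mu(y)\widehat P(y,x)$ for all $x,y\in X$. Let $V(x)=W(d(x_0,x))$, $x\in X$, for some $x_0\in X$ and some increasing function $W:\mathbb N_0\to(0,\infty)$. Assume that $$\inf\{P(x,y):x,y\in X,\ x\sim y\}>0,$$ that $\lim_{k\to\infty}W(k)=\infty$ and there is a constant $c\ge1$ with $c^{-1}W(k)\le W(k+1)\le cW(k)$ for all sufficiently large $k$, and that $\sup_{x\in X}\mu(x)<\infty$. Then the Feynman--Kac semigroup $\{\mathcal U_n:n\in\mathbb N_0\}$ related to the kernel $P$ (and the potential $V$) does not enjoy the IHC property.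
   Context: $X$ is a countably infinite set, $\mathbb N=\{1,2,\dots\}$, $\mathbb N_0=\mathbb N\cup\{0\}$. A graph $G=(X,E)$ has edge set $E\subset\{\{x,y\}:x,y\in X\}$; $x\sim y$ means $\{x,y\}\in E$. $G$ has finite geometry if every $x\in X$ has finitely many neighbours; it is connected if any two different vertices are joined by a path of successive neighbours; $d(x,y)$ is the graph (geodesic) distance, i.e. the length (number of edges) of a shortest path. A probability kernel satisfies $\sum_yP(x,y)=1$ for all $x$. Let $\mathcal U f(x)=\frac1{V(x)}\sum_{y}P(x,y)f(y)$ and $\widehat{\mathcal U}f(x)=\sum_y\widehat P(x,y)\frac1{V(y)}f(y)$ (mutually adjoint on $\ell^2(\mu)$), and $\mathcal U_n=\mathcal U^n$. Since $V\to\infty$ at infinity (outside finite sets), $\mathcal U,\widehat{\mathcal U}$ are compact on $\ell^2(\mu)$, and $\lambda_0:=\sup_{\lambda\in\sigma(\mathcal U)}|\lambda|=\sup_{\lambda\in\sigma(\widehat{\mathcal U})}|\lambda|>0$ is a simple eigenvalue of both; $\varphi_0,\widehat\varphi_0$ denote the corresponding strictly positive eigenfunctions (ground states), $\mathcal U\varphi_0=\lambda_0\varphi_0$, $\widehat{\mathcal U}\widehat\varphi_0=\lambda_0\widehat\varphi_0$, normalized by $\|\varphi_0\|_{\ell^2(\mu)}=\|\widehat\varphi_0\|_{\ell^2(\mu)}=1$. Let $\nu(x)=\varphi_0(x)\widehat\varphi_0(x)\mu(x)$ and $\mathcal Q_nf=\lambda_0^{-n}\varphi_0^{-1}\,\mathcal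 U_n(f\varphi_0)$ (the intrinsic semigroup). $\{\mathcal U_n\}$ has the IHC (intrinsic hypercontractivity) property if for every $1<p<q<\infty$ there is $n=n_{p,q}\in\mathbb N$ such that $\mathcal Q_n:\ell^p(\nu)\to\ell^q(\nu)$ is bounded. *)

theory Defs
  imports "HOL-Analysis.Analysis"
begin

text \<open>The countably infinite vertex set is the universe of the type \<open>'a\<close>; an edge is a set
  \<open>{x, y}\<close>, where \<open>x = y\<close> (a loop) is allowed.\<close>

definition graph :: "'a set set \<Rightarrow> bool" where
  "graph E \<longleftrightarrow> E \<subseteq> {{x, y} | x y. True}"

definition adj :: "'a set set \<Rightarrow> 'a \<Rightarrow> 'a \<Rightarrow> bool" where
  "adj E x y \<longleftrightarrow> {x, y} \<in> E"

definition finite_geometry :: "'a set set \<Rightarrow> bool" where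
  "finite_geometry E \<longleftrightarrow> (\<forall>x. finite {y. adj E x y})"

definition path_between :: "'a set set \<Rightarrow> 'a \<Rightarrow> 'a list \<Rightarrow> 'a \<Rightarrow> bool" where
  "path_between E x xs y \<longleftrightarrow> xs \<noteq> [] \<and> hd xs = x \<and> last xs = y \<and> successively (adj E) xs"

definition connected_graph :: "'a set set \<Rightarrow> bool" where
  "connected_graph E \<longleftrightarrow> (\<forall>x y. x \<noteq> y \<longrightarrow> (\<exists>xs. path_between E x xs y))"

text \<open>A path with \<open>n\<close> edges lists \<open>n + 1\<close> vertices. Vertices may repeat, which does not affect the
  minimum.\<close>

definition graph_dist :: "'a set set \<Rightarrow> 'a \<Rightarrow> 'a \<Rightarrow> nat" where
  "graph_dist E x y = (LEAST n. \<exists>xs. path_between E x xs y \<and> length xs = Suc n)"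

definition prob_kernel :: "('a \<Rightarrow> 'a \<Rightarrow> real) \<Rightarrow> bool" where
  "prob_kernel P \<longleftrightarrow> (\<forall>x y. 0 \<le> P x y \<and> P x y \<le> 1) \<and> (\<forall>x. (P x has_sum 1) UNIV)"

text \<open>Weighted sequence spaces, for \<open>0 < p < \<infinity>\<close>; a measure is given by its point masses.\<close>

definition ell :: "real \<Rightarrow> ('a \<Rightarrow> real) \<Rightarrow> ('a \<Rightarrow> 'b::real_normed_vector) set" where
  "ell p m = {f. (\<lambda>x. norm (f x) powr p * m x) summable_on UNIV}"

definition ell_norm :: "real \<Rightarrow> ('a \<Rightarrow> real) \<Rightarrow> ('a \<Rightarrow> 'b::real_normed_vector) \<Rightarrow> real" where
  "ell_norm p m f = (\<Sum>\<^sub>\<infinity>x. norm (f x) powr p * m x) powr (1 / p)"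

text \<open>The operators are bounded between spaces of complex-valued functions, as needed for the
  spectrum. Linearity is not part of the definition: it is used for operators that are linear by
  their form, and for inverses of such operators.\<close>

definition ell_bounded ::
  "real \<Rightarrow> ('a \<Rightarrow> real) \<Rightarrow> real \<Rightarrow> ('a \<Rightarrow> real) \<Rightarrow> (('a \<Rightarrow> complex) \<Rightarrow> ('a \<Rightarrow> complex)) \<Rightarrow> bool" where
  "ell_bounded p m q m' T \<longleftrightarrow>
     (\<exists>C. \<forall>f \<in> ell p m. T f \<in> ell q m' \<and> ell_norm q m' (T f) \<le> C * ell_norm p m f)"

definition ell2_spectrum :: "('a \<Rightarrow> real) \<Rightarrow> (('a \<Rightarrow> complex) \<Rightarrow> ('a \<Rightarrow> complex)) \<Rightarrow> complex set" where
  "ell2_spectrum m T = {z. \<not> (\<exists>R. ell_bounded 2 m 2 m R \<and>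
     (\<forall>f \<in> ell 2 m. R (\<lambda>x. z * f x - T f x) = f \<and> (\<lambda>x. z * R f x - T (R f) x) = f))}"

definition ell2_spectral_radius :: "('a \<Rightarrow> real) \<Rightarrow> (('a \<Rightarrow> complex) \<Rightarrow> ('a \<Rightarrow> complex)) \<Rightarrow> real" where
  "ell2_spectral_radius m T = (SUP z \<in> ell2_spectrum m T. cmod z)"

text \<open>The operators \<open>U\<close> and its adjoint. They are polymorphic in the values, so that they act both on
  complex-valued functions and on the real-valued ground states.\<close>

definition fk_op :: "('a \<Rightarrow> 'a \<Rightarrow> real) \<Rightarrow> ('a \<Rightarrow> real) \<Rightarrow> ('a \<Rightarrow> 'b::real_normed_vector) \<Rightarrow> 'a \<Rightarrow> 'b" where
  "fk_op P V f x = (1 / V x) *\<^sub>R (\<Sum>\<^sub>\<infinity>y. P x y *\<^sub>R f y)"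

definition fk_op_adj :: "('a \<Rightarrow> 'a \<Rightarrow> real) \<Rightarrow> ('a \<Rightarrow> real) \<Rightarrow> ('a \<Rightarrow> 'b::real_normed_vector) \<Rightarrow> 'a \<Rightarrow> 'b" where
  "fk_op_adj Phat V f x = (\<Sum>\<^sub>\<infinity>y. (Phat x y * (1 / V y)) *\<^sub>R f y)"

definition fk_semigroup ::
  "('a \<Rightarrow> 'a \<Rightarrow> real) \<Rightarrow> ('a \<Rightarrow> real) \<Rightarrow> nat \<Rightarrow> ('a \<Rightarrow> 'b::real_normed_vector) \<Rightarrow> 'a \<Rightarrow> 'b" where
  "fk_semigroup P V n = fk_op P V ^^ n"

definition ground_state ::
  "('a \<Rightarrow> real) \<Rightarrow> (('a \<Rightarrow> real) \<Rightarrow> ('a \<Rightarrow> real)) \<Rightarrow> real \<Rightarrow> ('a \<Rightarrow> real) \<Rightarrow> bool" where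
  "ground_state m T lam phi \<longleftrightarrow> phi \<in> ell 2 m \<and> (\<forall>x. phi x > 0) \<and>
     (\<forall>x. T phi x = lam * phi x) \<and> ell_norm 2 m phi = 1"

definition intrinsic_semigroup ::
  "('a \<Rightarrow> 'a \<Rightarrow> real) \<Rightarrow> ('a \<Rightarrow> real) \<Rightarrow> real \<Rightarrow> ('a \<Rightarrow> real) \<Rightarrow> nat \<Rightarrow> ('a \<Rightarrow> complex) \<Rightarrow> 'a \<Rightarrow> complex" where
  "intrinsic_semigroup P V lam phi n f x =
     (1 / (lam ^ n * phi x)) *\<^sub>R fk_semigroup P V n (\<lambda>y. phi y *\<^sub>R f y) x"

text \<open>Intrinsic hypercontractivity, relative to the eigenvalue \<open>lam\<close> and the ground states \<open>phi\<close> of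
  \<open>U\<close> and \<open>phihat\<close> of its adjoint.\<close>

definition IHC ::
  "('a \<Rightarrow> 'a \<Rightarrow> real) \<Rightarrow> ('a \<Rightarrow> real) \<Rightarrow> ('a \<Rightarrow> real) \<Rightarrow> real \<Rightarrow> ('a \<Rightarrow> real) \<Rightarrow> ('a \<Rightarrow> real) \<Rightarrow> bool" where
  "IHC P V m lam phi phihat \<longleftrightarrow>
     (let nu = (\<lambda>x. phi x * phihat x * m x) in
      \<forall>p q. 1 < p \<and> p < q \<longrightarrow>
        (\<exists>n\<ge>1. ell_bounded p nu q nu (intrinsic_semigroup P V lam phi n)))"

end

theory Submission
  imports Defs
begin

text \<open>Iterating \<open>\<phi>\<^sub>0 = \<lambda>\<^sub>0\<inverse> U \<phi>\<^sub>0\<close> shows that \<open>\<phi>\<^sub>0 \<surd>\<mu>\<close> decays faster than every power of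
  \<open>1/V\<close>, and hence so does \<open>\<nu>\<close>, because the normalization of the dual ground state gives
  \<open>\<nu> \<le> \<phi>\<^sub>0 \<surd>\<mu>\<close>. On the other hand, for an edge \<open>{x, z}\<close>, walking back and forth along it shows that
  \<open>Q\<^sub>n 1\<^bsub>{x,z}\<^esub>\<close> is at least a constant times \<open>V(x)\<close> to the power \<open>-(n+1)\<close> at \<open>x\<close>. If \<open>Q\<^sub>n\<close> were bounded
  from \<open>\<ell>\<^sup>2(\<nu>)\<close> to \<open>\<ell>\<^sup>4(\<nu>)\<close>, then for \<open>\<nu>(z) \<le> \<nu>(x)\<close> this would bound \<open>\<nu>(x)\<close> from below by a constant
  times a fixed power of \<open>1/V(x)\<close>, which fails far away from \<open>x\<^sub>0\<close>.\<close>

section \<open>Graph distance\<close>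

lemma path_between_snoc:
  "path_between E x (xs @ [z]) w \<and> xs \<noteq> [] \<longleftrightarrow>
    w = z \<and> path_between E x xs (last xs) \<and> adj E (last xs) z"
  by (auto simp: path_between_def successively_append_iff)

lemma adj_commute: "adj E x y \<longleftrightarrow> adj E y x"
  by (simp add: adj_def insert_commute)

text \<open>\<open>LEAST\<close> is meaningful only once some path exists.
  \<open>connected_graph\<close> speaks of distinct vertices, so \<open>x = y\<close> needs the
  one-vertex path.\<close>

lemma graph_dist_attained:
  assumes "connected_graph E"
  shows "\<exists>xs. path_between E x xs y \<and> length xs = Suc (graph_dist E x y)"
proof -
  obtain xs where xs: "path_between E x xs y"
  proof (cases "x = y")
    case True
    then have "path_between E x [x] y"
      by (simp add: path_between_def)
    then show ?thesis by (rule that)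
  next
    case False
    then show ?thesis using assms that by (auto simp: connected_graph_def)
  qed
  then have "xs \<noteq> []" by (simp add: path_between_def)
  then have "length xs = Suc (length xs - 1)" by simp
  with xs have "\<exists>n. \<exists>xs. path_between E x xs y \<and> length xs = Suc n" by blast
  then show ?thesis unfolding graph_dist_def by (rule LeastI_ex)
qed

lemma graph_dist_le:
  assumes "path_between E x xs y" "length xs = Suc n"
  shows "graph_dist E x y \<le> n"
  unfolding graph_dist_def using assms by (intro Least_le) blast

lemma graph_dist_adj_le:
  assumes "connected_graph E" "adj E y z"
  shows "graph_dist E x z \<le> Suc (graph_dist E x y)"
proof -
  obtain xs where xs: "path_between E x xs y" "length xs = Suc (graph_dist E x y)"
    using graph_dist_attained[OF assms(1)] by blast
  then have "xs \<noteq> []" "last xs = y" by (auto simp: path_between_def)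
  then have "path_between E x (xs @ [z]) z"
    using xs assms(2) path_between_snoc[of E x xs z z] by auto
  then show ?thesis by (rule graph_dist_le) (simp add: xs)
qed

lemma finite_path_ends:
  assumes "finite_geometry E"
  shows "finite {y. \<exists>xs. path_between E x xs y \<and> length xs = Suc n}"
proof (induction n)
  case 0
  have "{y. \<exists>xs. path_between E x xs y \<and> length xs = Suc 0} \<subseteq> {x}"
    by (auto simp: path_between_def length_Suc_conv)
  then show ?case by (rule finite_subset) simp
next
  case (Suc n)
  let ?R = "\<lambda>n. {y. \<exists>xs. path_between E x xs y \<and> length xs = Suc n}"
  have "?R (Suc n) \<subseteq> (\<Union>y\<in>?R n. {z. adj E y z})"
  proof
    fix z assume "z \<in> ?R (Suc n)"
    then obtain xs where xs: "path_between E x xs z" "length xs = Suc (Suc n)" by blast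
    then obtain ys w where ys: "xs = ys @ [w]" "length ys = Suc n"
      by (metis length_Suc_conv_rev)
    then have "ys \<noteq> []" by auto
    then have "z = w" "path_between E x ys (last ys)" "adj E (last ys) w"
      using xs(1) path_between_snoc[of E x ys w z] ys(1) by auto
    then show "z \<in> (\<Union>y\<in>?R n. {z. adj E y z})" using ys(2) by blast
  qed
  moreover have "finite (\<Union>y\<in>?R n. {z. adj E y z})"
    using Suc assms by (auto simp: finite_geometry_def)
  ultimately show ?case by (rule finite_subset)
qed

text \<open>If all distances were below \<open>k\<close>, finitely many finite sets of path ends
  would exhaust the infinite vertex set.\<close>

lemma graph_dist_unbounded:
  assumes "infinite (UNIV :: 'a set)" "connected_graph E" "finite_geometry E"
  shows "\<exists>y :: 'a. graph_dist E x y \<ge> k"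
proof (rule ccontr)
  assume "\<nexists>y. graph_dist E x y \<ge> k"
  then have "UNIV \<subseteq> (\<Union>n<k. {y. \<exists>xs. path_between E x xs y \<and> length xs = Suc n})"
    using graph_dist_attained[OF assms(2), of x] by (force simp: not_le)
  moreover have "finite \<dots>"
    using finite_path_ends[OF assms(3)] by blast
  ultimately show False using assms(1) finite_subset by blast
qed

section \<open>Weighted sequence spaces\<close>

text \<open>A single term of a convergent nonnegative series is at most its sum; this turns norm
  bounds into pointwise ones.\<close>

lemma ell_pointwise_le:
  assumes "f \<in> ell p m" "p > 0" "\<And>x. m x \<ge> 0"
  shows "norm (f x) * m x powr (1 / p) \<le> ell_norm p m f"
proof -
  let ?g = "\<lambda>x. norm (f x) powr p * m x"
  have "?g x \<le> infsum ?g UNIV"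
    using finite_sum_le_infsum[of ?g UNIV "{x}"] assms by (simp add: ell_def)
  then have "?g x powr (1 / p) \<le> ell_norm p m f"
    unfolding ell_norm_def using assms by (intro powr_mono2) auto
  also have "?g x powr (1 / p) = norm (f x) * m x powr (1 / p)"
    using assms by (simp add: powr_mult powr_powr)
  finally show ?thesis .
qed

text \<open>Off \<open>A\<close> the summand vanishes for every \<open>p\<close>, because
  \<open>0 powr p\<close> is \<open>0\<close> by convention even at \<open>p = 0\<close>.\<close>

lemma ell_indicator:
  assumes "finite A"
  shows "(indicator A :: 'a \<Rightarrow> 'b::real_normed_algebra_1) \<in> ell p m"
    and "ell_norm p m (indicator A :: 'a \<Rightarrow> 'b) = (\<Sum>x\<in>A. m x) powr (1 / p)"
proof -
  let ?g = "\<lambda>x. norm (indicator A x :: 'b) powr p * m x"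
  have "(?g has_sum sum ?g A) UNIV"
    using assms by (intro has_sum_finite_neutralI) auto
  moreover have "sum ?g A = sum m A" by (intro sum.cong) auto
  ultimately have "(?g has_sum sum m A) UNIV" by simp
  then show "(indicator A :: 'a \<Rightarrow> 'b) \<in> ell p m"
    and "ell_norm p m (indicator A :: 'a \<Rightarrow> 'b) = (\<Sum>x\<in>A. m x) powr (1 / p)"
    by (auto simp: ell_def ell_norm_def infsumI summable_on_def)
qed

lemma ground_state_weight_le:
  assumes "ground_state m T lam phi" "\<And>x. m x > 0"
  shows "phi x * m x powr (1 / 2) \<le> 1"
  using ell_pointwise_le[of phi 2 m x] assms
  by (simp add: ground_state_def less_imp_le)

section \<open>Uniformly elliptic kernels\<close>

locale elliptic_kernel =
  fixes E :: "'a set set" and P :: "'a \<Rightarrow> 'a \<Rightarrow> real" and eps :: real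
  assumes finite_geometry: "finite_geometry E"
    and prob_kernel: "prob_kernel P"
    and pos_iff_adj: "P x y > 0 \<longleftrightarrow> adj E x y"
    and eps_pos: "eps > 0"
    and eps_le: "adj E x y \<Longrightarrow> eps \<le> P x y"
begin

lemma finite_neighbours [simp]: "finite {y. adj E x y}"
  using finite_geometry by (simp add: finite_geometry_def)

lemma P_nonneg: "0 \<le> P x y"
  using prob_kernel by (simp add: prob_kernel_def)

lemma P_eq_0: "\<not> adj E x y \<Longrightarrow> P x y = 0"
  using pos_iff_adj[of x y] P_nonneg[of x y] by simp

lemma fk_op_eq_sum:
  "fk_op P V f x = (1 / V x) *\<^sub>R (\<Sum>y | adj E x y. P x y *\<^sub>R f y)"
proof -
  have "((\<lambda>y. P x y *\<^sub>R f y) has_sum (\<Sum>y | adj E x y. P x y *\<^sub>R f y)) UNIV"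
    by (intro has_sum_finite_neutralI) (auto simp: P_eq_0)
  then show ?thesis unfolding fk_op_def by (simp add: infsumI)
qed

lemma sum_P: "(\<Sum>y | adj E x y. P x y) = 1"
proof -
  have "(P x has_sum (\<Sum>y | adj E x y. P x y)) UNIV"
    by (intro has_sum_finite_neutralI) (auto simp: P_eq_0)
  moreover have "(P x has_sum 1) UNIV"
    using prob_kernel by (simp add: prob_kernel_def)
  ultimately show ?thesis by (rule has_sum_unique)
qed

lemma neighbour_exists: "\<exists>y. adj E x y"
  using sum_P[of x] by (metis (mono_tags, lifting) empty_Collect_eq sum.empty zero_neq_one)

lemma fk_op_ge:
  fixes f :: "'a \<Rightarrow> real"
  assumes "\<And>y. f y \<ge> 0" "V x > 0" "adj E x y"
  shows "eps / V x * f y \<le> fk_op P V f x"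
proof -
  have "eps * f y \<le> P x y * f y"
    using eps_le assms by (intro mult_right_mono) auto
  also have "\<dots> \<le> (\<Sum>y | adj E x y. P x y * f y)"
    using assms P_nonneg by (intro member_le_sum) auto
  finally show ?thesis
    using assms by (simp add: fk_op_eq_sum divide_simps)
qed

lemma fk_op_le:
  fixes f :: "'a \<Rightarrow> real"
  assumes "\<And>y. adj E x y \<Longrightarrow> f y \<le> B" "V x > 0"
  shows "fk_op P V f x \<le> B / V x"
proof -
  have "(\<Sum>y | adj E x y. P x y * f y) \<le> (\<Sum>y | adj E x y. P x y * B)"
    using assms P_nonneg by (intro sum_mono mult_left_mono) auto
  also have "\<dots> = B" by (simp add: sum_P flip: sum_distrib_right)
  finally show ?thesis
    using assms by (simp add: fk_op_eq_sum divide_simps)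
qed

text \<open>\<open>IHC\<close> concerns complex functions, while the order estimates need real ones;
  this passes between the two.\<close>

lemma fk_semigroup_of_real:
  "fk_semigroup P V n (\<lambda>y. complex_of_real (f y)) =
    (\<lambda>y. complex_of_real (fk_semigroup P V n f y))"
  by (induction n) (auto simp: fk_semigroup_def fk_op_eq_sum scaleR_conv_of_real)

text \<open>Only the walk alternating between \<open>x\<close> and \<open>z\<close> is kept: each
  step has probability at least \<open>eps\<close> and meets a potential of at most
  \<open>T\<close>.\<close>

lemma fk_semigroup_ge_on_edge:
  fixes f :: "'a \<Rightarrow> real"
  assumes "\<And>y. f y \<ge> 0" "\<And>y. V y > 0" "adj E x z"
    and b: "0 \<le> b" "b \<le> f x" "b \<le> f z"
    and T: "V x \<le> T" "V z \<le> T"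
  shows "(eps / T) ^ n * b \<le> fk_semigroup P V n f x"
proof -
  have T0: "T > 0" using T(1) assms(2)[of x] by linarith
  \<comment> \<open>The bound is carried at both ends, since a step from one end evaluates the
    previous iterate at the other; nonnegativity allows discarding all other neighbours.\<close>
  have "(\<forall>y. fk_semigroup P V n f y \<ge> 0) \<and>
    (eps / T) ^ n * b \<le> fk_semigroup P V n f x \<and> (eps / T) ^ n * b \<le> fk_semigroup P V n f z"
  proof (induction n)
    case 0
    then show ?case using assms by (simp add: fk_semigroup_def)
  next
    case (Suc n)
    let ?g = "fk_semigroup P V n f"
    have Suc_eq: "fk_semigroup P V (Suc n) f = fk_op P V ?g"
      by (simp add: fk_semigroup_def)
    have nonneg: "fk_op P V ?g y \<ge> 0" for y
      using Suc P_nonneg assms(2)[of y]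
      by (auto simp: fk_op_eq_sum intro!: divide_nonneg_pos sum_nonneg)
    have step: "(eps / T) ^ Suc n * b \<le> fk_op P V ?g u"
      if "adj E u v" "V u \<le> T" "(eps / T) ^ n * b \<le> ?g v" for u v
    proof -
      have "(eps / T) ^ Suc n * b = (eps / T) * ((eps / T) ^ n * b)" by simp
      also have "\<dots> \<le> (eps / V u) * ?g v"
        using that assms(2)[of u] eps_pos T0 b
        by (intro mult_mono divide_left_mono) auto
      also have "\<dots> \<le> fk_op P V ?g u"
        using Suc assms(2)[of u] that by (intro fk_op_ge) auto
      finally show ?thesis .
    qed
    show ?case
      using nonneg step[of x z] step[of z x] Suc assms(3) T
      unfolding Suc_eq by (auto simp: adj_commute)
  qed
  then show ?thesis by blast
qed

text \<open>No spectral theory is involved: the term of one neighbour already makes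
  \<open>fk_op P V f x\<close> positive.\<close>

lemma eigenvalue_pos:
  fixes f :: "'a \<Rightarrow> real"
  assumes "\<And>y. f y > 0" "V x > 0" "fk_op P V f x = lam * f x"
  shows "lam > 0"
proof -
  obtain y where y: "adj E x y" using neighbour_exists by blast
  have "0 < eps / V x * f y" using eps_pos assms by simp
  also have "\<dots> \<le> lam * f x"
    using fk_op_ge[of f V x y] assms y by (simp add: less_imp_le)
  finally show ?thesis using assms(1)[of x] by (simp add: zero_less_mult_iff)
qed

lemma intrinsic_semigroup_edge_ge:
  fixes f :: "'a \<Rightarrow> real"
  assumes phi: "\<And>y. phi y > 0" and V: "\<And>y. V y > 0"
    and eigen: "\<And>y. fk_op P V phi y = lam * phi y"
    and "adj E x z" and T: "V x \<le> T" "V z \<le> T" and "eps \<le> lam * T"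
  shows "(eps / (lam * T)) ^ Suc n \<le> cmod (intrinsic_semigroup P V lam phi n (indicator {x, z}) x)"
proof -
  have lam: "lam > 0" using eigenvalue_pos[of phi V x lam] assms by blast
  have T0: "T > 0" using T(1) V[of x] by linarith
  define g where "g = (\<lambda>y. phi y * indicator {x, z} y)"
  \<comment> \<open>\<open>b\<close> bounds \<open>phi\<close> from below at both ends: at
    \<open>z\<close> by the eigenvalue equation and one step to \<open>x\<close>, at
    \<open>x\<close> because \<open>eps <= lam * T\<close>. Its extra factor turns the exponent
    \<open>n\<close> into \<open>Suc n\<close>.\<close>
  define b where "b = eps / (lam * T) * phi x"
  have zx: "adj E z x" using assms(4) by (simp add: adj_commute)
  have "eps / T * phi x \<le> eps / V z * phi x"
    using T V[of z] T0 eps_pos phi[of x] by (intro mult_right_mono divide_left_mono) auto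
  also have "\<dots> \<le> lam * phi z"
    using fk_op_ge[of phi V z x] phi V zx eigen by (simp add: less_imp_le)
  finally have "b \<le> phi z"
    using lam T0 by (simp add: b_def field_simps)
  moreover have "b \<le> phi x"
    using lam T0 assms(7) phi[of x] by (simp add: b_def divide_simps)
  ultimately have "(eps / T) ^ n * b \<le> fk_semigroup P V n g x"
    using phi V assms(4) T eps_pos lam T0
    by (intro fk_semigroup_ge_on_edge[where z = z]) (auto simp: g_def b_def less_imp_le)
  then have "(eps / T) ^ n * b / (lam ^ n * phi x) \<le> fk_semigroup P V n g x / (lam ^ n * phi x)"
    using lam phi by (intro divide_right_mono) (auto simp: less_imp_le)
  moreover have "(eps / T) ^ n * b / (lam ^ n * phi x) = (eps / (lam * T)) ^ Suc n"
    using lam phi[of x] T0 by (simp add: b_def field_simps)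
  moreover have "intrinsic_semigroup P V lam phi n (indicator {x, z}) x =
      complex_of_real (fk_semigroup P V n g x / (lam ^ n * phi x))"
  proof -
    have "(\<lambda>y. phi y *\<^sub>R (indicator {x, z} y :: complex)) = (\<lambda>y. complex_of_real (g y))"
      by (auto simp: g_def scaleR_conv_of_real split: split_indicator)
    then show ?thesis
      by (simp add: intrinsic_semigroup_def fk_semigroup_of_real scaleR_conv_of_real)
  qed
  ultimately show ?thesis by (metis norm_of_real abs_ge_self order_trans)
qed

text \<open>Each use of the eigenvalue equation gains a factor \<open>1/V\<close>; moving to a neighbour costs only
  constants, since \<open>\<mu>\<close> and \<open>V\<close> are comparable along edges.\<close>

lemma eigenfunction_decay:
  fixes phi mu V :: "'a \<Rightarrow> real" and r :: "'a \<Rightarrow> nat"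
  assumes V: "\<And>x. V x > 0" and mu: "\<And>x. mu x > 0" and "lam > 0" "c > 0"
    and eigen: "\<And>x. fk_op P V phi x = lam * phi x"
    and bound: "\<And>x. phi x * mu x powr (1 / 2) \<le> 1"
    and mu_adj: "\<And>x y. adj E x y \<Longrightarrow> eps * mu x \<le> mu y"
    and r_adj: "\<And>x y. adj E x y \<Longrightarrow> r x \<le> Suc (r y)"
    and V_adj: "\<And>x y. adj E x y \<Longrightarrow> k0 \<le> r x \<Longrightarrow> V x \<le> c * V y"
  shows "\<exists>C\<ge>0. \<exists>k. \<forall>x. k \<le> r x \<longrightarrow> phi x * mu x powr (1 / 2) \<le> C / V x ^ m"
proof (induction m)
  case 0
  then show ?case using bound by (intro exI[of _ 1]) auto
next
  case (Suc m)
  then obtain C k where C: "C \<ge> 0"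
    and k: "\<And>x. k \<le> r x \<Longrightarrow> phi x * mu x powr (1 / 2) \<le> C / V x ^ m" by blast
  define D where "D = C * c ^ m / (eps powr (1 / 2) * lam)"
  \<comment> \<open>With \<open>Suc k\<close>, every neighbour \<open>y\<close> of \<open>x\<close>
    still satisfies \<open>k <= r y\<close>, as the induction hypothesis requires.\<close>
  have "phi x * mu x powr (1 / 2) \<le> D / V x ^ Suc m" if x: "max k0 (Suc k) \<le> r x" for x
  proof -
    have s: "mu y powr (1 / 2) > 0" for y using mu[of y] by simp
    have e: "eps powr (1 / 2) > 0" using eps_pos by simp
    \<comment> \<open>\<open>B\<close> is the induction hypothesis at a neighbour \<open>y\<close>,
      with \<open>V y\<close> and \<open>mu y\<close> replaced by multiples of \<open>V x\<close>
      and \<open>mu x\<close>. Being uniform in \<open>y\<close>, it survives averaging.\<close>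
    define B where "B = C * c ^ m / (V x ^ m * (eps powr (1 / 2) * mu x powr (1 / 2)))"
    have "phi y \<le> B" if y: "adj E x y" for y
    proof -
      have "k \<le> r y" using r_adj[OF y] x by simp
      then have "phi y \<le> C / V y ^ m / mu y powr (1 / 2)"
        using k[of y] pos_le_divide_eq[OF s[of y]] by blast
      also have "\<dots> \<le> C * c ^ m / V x ^ m / mu y powr (1 / 2)"
      proof (intro divide_right_mono)
        have "V x ^ m \<le> (c * V y) ^ m"
          using V_adj[OF y] x V[of x] by (intro power_mono) (auto simp: less_imp_le)
        then have "C * V x ^ m \<le> C * (c ^ m * V y ^ m)"
          using C by (intro mult_left_mono) (auto simp: power_mult_distrib)
        then show "C / V y ^ m \<le> C * c ^ m / V x ^ m"
          using V[of x] V[of y] by (simp add: field_simps)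
      qed (use s[of y] in simp)
      also have "\<dots> \<le> C * c ^ m / V x ^ m / (eps powr (1 / 2) * mu x powr (1 / 2))"
      proof (intro divide_left_mono)
        have "eps powr (1 / 2) * mu x powr (1 / 2) = (eps * mu x) powr (1 / 2)"
          using eps_pos mu[of x] by (simp add: powr_mult)
        also have "\<dots> \<le> mu y powr (1 / 2)"
          using mu_adj[OF y] eps_pos mu[of x] by (intro powr_mono2) auto
        finally show "eps powr (1 / 2) * mu x powr (1 / 2) \<le> mu y powr (1 / 2)" .
        show "0 \<le> C * c ^ m / V x ^ m" using C V[of x] \<open>c > 0\<close> by simp
        show "0 < mu y powr (1 / 2) * (eps powr (1 / 2) * mu x powr (1 / 2))"
          using s e by simp
      qed
      finally show ?thesis by (simp add: B_def)
    qed
    then have "lam * phi x \<le> B / V x"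
      using fk_op_le[of x phi B V] eigen V by simp
    then have "phi x \<le> B / V x / lam"
      using pos_le_divide_eq[OF \<open>lam > 0\<close>, of "phi x" "B / V x"] by (simp only: mult.commute)
    then have "phi x * mu x powr (1 / 2) \<le> B / V x / lam * mu x powr (1 / 2)"
      using s[of x] by (intro mult_right_mono) auto
    also have "\<dots> = D / V x ^ Suc m"
      using s[of x] e V[of x] \<open>lam > 0\<close> by (simp add: B_def D_def field_simps)
    finally show ?thesis .
  qed
  moreover have "D \<ge> 0"
    using C \<open>c > 0\<close> \<open>lam > 0\<close> by (simp add: D_def)
  ultimately show ?case by blast
qed

end

section \<open>Failure of intrinsic hypercontractivity\<close>

theorem proposition5p2:
  fixes E :: "'a set set" and P Phat :: "'a \<Rightarrow> 'a \<Rightarrow> real" and mu V :: "'a \<Rightarrow> real"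
    and x0 :: 'a and W :: "nat \<Rightarrow> real" and lam0 :: real and phi phihat :: "'a \<Rightarrow> real"
  assumes "countable (UNIV :: 'a set)" and "infinite (UNIV :: 'a set)"
    and "graph E" and "connected_graph E" and "finite_geometry E"
    and "prob_kernel P" and "\<And>x y. P x y > 0 \<longleftrightarrow> adj E x y"
    and "prob_kernel Phat" and "\<And>x. mu x > 0"
    and "\<And>x y. mu x * P x y = mu y * Phat y x"
    and "mono W" and "\<And>k. W k > 0" and "\<And>x. V x = W (graph_dist E x0 x)"
    and "Inf {P x y | x y. adj E x y} > 0"
    and "filterlim W at_top sequentially"
    and "\<exists>c\<ge>1. \<forall>\<^sub>F k in sequentially. inverse c * W k \<le> W (k + 1) \<and> W (k + 1) \<le> c * W k"
    and "bdd_above (range mu)"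
    and "lam0 = ell2_spectral_radius mu (fk_op P V)"
    and "ground_state mu (fk_op P V) lam0 phi"
    and "ground_state mu (fk_op_adj Phat V) lam0 phihat"
  shows "\<not> IHC P V mu lam0 phi phihat"
proof
  assume IHC: "IHC P V mu lam0 phi phihat"
  define eps where "eps = Inf {P x y | x y. adj E x y}"
  have P_ge_eps: "eps \<le> P x y" if "adj E x y" for x y
    unfolding eps_def
    using assms(6) that by (intro cInf_lower bdd_belowI[of _ 0]) (auto simp: prob_kernel_def)
  interpret elliptic_kernel E P eps
    using assms(5,6,7,14) P_ge_eps by unfold_locales (auto simp: eps_def)
  define nu where "nu = (\<lambda>x. phi x * phihat x * mu x)"
  define r where "r = graph_dist E x0"
  have V_eq: "V x = W (r x)" for x by (simp add: r_def assms(13))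
  have V_pos: "V x > 0" for x by (simp add: V_eq assms(12))
  have phi_pos: "phi x > 0" and phihat_pos: "phihat x > 0"
    and eigen: "fk_op P V phi x = lam0 * phi x" for x
    using assms(19,20) by (auto simp: ground_state_def)
  have nu_pos: "nu x > 0" for x
    using phi_pos phihat_pos assms(9) by (simp add: nu_def)
  have lam_pos: "lam0 > 0"
    using eigenvalue_pos[of phi V x0] phi_pos V_pos eigen by blast
  obtain c k0 where c: "c \<ge> 1" and k0: "\<And>k. k \<ge> k0 \<Longrightarrow> W (Suc k) \<le> c * W k"
    using assms(16) by (auto simp: eventually_sequentially)
  have r_adj: "r x \<le> Suc (r y)" if "adj E x y" for x y
    using graph_dist_adj_le[OF assms(4), of y x x0] that by (simp add: r_def adj_commute)
  \<comment> \<open>\<open>Suc k0 <= r x\<close> forces \<open>k0 <= r y\<close>, where the growth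
    bound on \<open>W\<close> applies.\<close>
  have V_adj: "V x \<le> c * V y" if "adj E x y" "Suc k0 \<le> r x" for x y
  proof -
    have "W (r x) \<le> W (Suc (r y))"
      using r_adj[OF that(1)] assms(11) by (simp add: monoD)
    also have "\<dots> \<le> c * W (r y)"
      using r_adj[OF that(1)] that(2) by (intro k0) simp
    finally show ?thesis by (simp add: V_eq)
  qed
  \<comment> \<open>The balance relation turns \<open>mu x * P x y\<close> into
    \<open>mu y * Phat y x\<close>, and \<open>Phat y x <= 1\<close>.\<close>
  have mu_adj: "eps * mu x \<le> mu y" if "adj E x y" for x y
  proof -
    have "eps * mu x \<le> mu x * P x y"
      using P_ge_eps[OF that] assms(9)[of x] by (simp add: mult.commute)
    also have "\<dots> \<le> mu y"
      using assms(8) assms(9)[of y] unfolding assms(10) by (simp add: prob_kernel_def)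
    finally show ?thesis .
  qed
  \<comment> \<open>For \<open>p = 2\<close>, \<open>q = 4\<close> the test on an edge compares
    \<open>nu x powr (1/4)\<close> with \<open>nu x powr (1/2)\<close>, which bounds
    \<open>nu x\<close> from below.\<close>
  obtain n C0 where
    bounded: "\<And>f. f \<in> ell 2 nu \<Longrightarrow> intrinsic_semigroup P V lam0 phi n f \<in> ell 4 nu \<and>
      ell_norm 4 nu (intrinsic_semigroup P V lam0 phi n f) \<le> C0 * ell_norm 2 nu f"
  proof -
    have "\<exists>n\<ge>1. ell_bounded 2 nu 4 nu (intrinsic_semigroup P V lam0 phi n)"
      using IHC unfolding IHC_def Let_def nu_def[symmetric]
      by (elim allE[of _ 2] allE[of _ 4]) auto
    then show ?thesis using that unfolding ell_bounded_def by blast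
  qed
  \<comment> \<open>The fourth power of the lower bound for the semigroup is of order
    \<open>V x\<close> to the power \<open>-m\<close>. Decay of order \<open>Suc m\<close> then
    leaves one factor \<open>V x\<close> to be bounded.\<close>
  define m where "m = 4 * Suc n"
  obtain C k1 where "C \<ge> 0"
    and decay: "\<And>x. k1 \<le> r x \<Longrightarrow> phi x * mu x powr (1 / 2) \<le> C / V x ^ Suc m"
  proof -
    have "c > 0" using c by simp
    then have "\<exists>C\<ge>0. \<exists>k. \<forall>x. k \<le> r x \<longrightarrow> phi x * mu x powr (1 / 2) \<le> C / V x ^ Suc m"
      using V_pos assms(9) lam_pos eigen ground_state_weight_le[OF assms(19,9)]
        mu_adj r_adj V_adj
      by (intro eigenfunction_decay[where lam = lam0 and c = c and ?k0.0 = "Suc k0"]) auto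
    then show ?thesis using that by blast
  qed
  \<comment> \<open>The weight \<open>mu\<close> is split evenly: \<open>phi\<close> supplies the
    decay, and the normalization of \<open>phihat\<close> bounds the other factor by 1.\<close>
  have nu_decay: "nu x \<le> C / V x ^ Suc m" if "k1 \<le> r x" for x
  proof -
    have "nu x = (phi x * mu x powr (1 / 2)) * (phihat x * mu x powr (1 / 2))"
      using assms(9)[of x] by (simp add: nu_def flip: powr_add)
    also have "\<dots> \<le> (C / V x ^ Suc m) * 1"
    proof (intro mult_mono)
      show "0 \<le> C / V x ^ Suc m" using \<open>C \<ge> 0\<close> V_pos[of x] by simp
      show "0 \<le> phihat x * mu x powr (1 / 2)" using phihat_pos[of x] by simp
    qed (fact decay[OF that] ground_state_weight_le[OF assms(20,9)])+
    finally show ?thesis by simp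
  qed
  have V_bounded: "V x \<le> 4 * C0 ^ 4 * C * (lam0 * c / eps) ^ m"
    if edge: "adj E x z" and far: "max k1 (Suc k0) \<le> r x" "Suc k0 \<le> r z"
      and large: "eps / lam0 \<le> V x" and nu_le: "nu z \<le> nu x" for x z
  proof -
    let ?Q = "intrinsic_semigroup P V lam0 phi n (indicator {x, z})"
    \<comment> \<open>This is the edge estimate with \<open>T = c * V x\<close>, which dominates
      \<open>V\<close> at both ends.\<close>
    define a where "a = eps / (lam0 * (c * V x))"
    have "a > 0" using eps_pos lam_pos c V_pos[of x] by (simp add: a_def)
    have Vx: "V x \<le> c * V x" using c V_pos[of x] by simp
    have "eps \<le> lam0 * V x"
      using large lam_pos by (simp add: field_simps)
    also have "\<dots> \<le> lam0 * (c * V x)"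
      using Vx lam_pos by (intro mult_left_mono) auto
    finally have "eps \<le> lam0 * (c * V x)" .
    moreover have "V z \<le> c * V x"
      using V_adj[of z x] edge far by (simp add: adj_commute)
    ultimately have "a ^ Suc n \<le> cmod (?Q x)"
      unfolding a_def using Vx edge phi_pos V_pos eigen
      by (intro intrinsic_semigroup_edge_ge) auto
    then have "a ^ Suc n * nu x powr (1 / 4) \<le> cmod (?Q x) * nu x powr (1 / 4)"
      by (intro mult_right_mono) auto
    also have "\<dots> \<le> ell_norm 4 nu ?Q"
      using bounded[OF ell_indicator(1), of "{x, z}"] nu_pos
      by (intro ell_pointwise_le) (auto simp: less_imp_le)
    also have "\<dots> \<le> C0 * ell_norm 2 nu (indicator {x, z} :: 'a \<Rightarrow> complex)"
      using bounded[OF ell_indicator(1), of "{x, z}"] by blast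
    also have "\<dots> = C0 * (\<Sum>y\<in>{x, z}. nu y) powr (1 / 2)"
      by (simp add: ell_indicator(2))
    \<comment> \<open>The sign of \<open>C0\<close> is unknown, hence the absolute value. For a
      loop, \<open>{x, z}\<close> is a single vertex.\<close>
    also have "\<dots> \<le> \<bar>C0\<bar> * (2 * nu x) powr (1 / 2)"
    proof (intro mult_mono powr_mono2)
      show "(\<Sum>y\<in>{x, z}. nu y) \<le> 2 * nu x"
        using nu_le nu_pos[of x] by (cases "x = z") auto
    qed (auto intro!: sum_nonneg less_imp_le[OF nu_pos])
    finally have "(a ^ Suc n * nu x powr (1 / 4)) ^ 4 \<le> (\<bar>C0\<bar> * (2 * nu x) powr (1 / 2)) ^ 4"
      using \<open>a > 0\<close> by (intro power_mono) auto
    moreover have "(nu x powr (1 / 4)) ^ 4 = nu x" "((2 * nu x) powr (1 / 2)) ^ 4 = 4 * nu x ^ 2"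
      using nu_pos[of x] by (simp_all add: powr_power power_mult_distrib)
    ultimately have "a ^ m * nu x \<le> 4 * C0 ^ 4 * nu x * nu x"
      by (simp only: m_def power_mult_distrib power_mult[symmetric] mult.commute[of "Suc n" 4]
          power_even_abs_numeral even_numeral) (simp add: power2_eq_square)
    then have "a ^ m \<le> 4 * C0 ^ 4 * nu x"
      using nu_pos[of x] by (simp add: mult_le_cancel_right)
    also have "\<dots> \<le> 4 * C0 ^ 4 * (C / V x ^ Suc m)"
      using nu_decay[of x] far by (intro mult_left_mono) auto
    finally have "a ^ m * V x ^ Suc m \<le> 4 * C0 ^ 4 * C"
      using V_pos[of x] by (simp add: field_simps)
    then have "(a * V x) ^ m * V x \<le> 4 * C0 ^ 4 * C"
      by (simp add: power_mult_distrib mult_ac)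
    \<comment> \<open>The potential cancels in \<open>a * V x\<close>, so the resulting bound on
      \<open>V x\<close> is independent of the edge.\<close>
    moreover have "a * V x = inverse (lam0 * c / eps)"
      using V_pos[of x] by (simp add: a_def field_simps)
    ultimately have "inverse ((lam0 * c / eps) ^ m) * V x \<le> 4 * C0 ^ 4 * C"
      by (simp only: power_inverse)
    then show ?thesis
      using lam_pos c eps_pos by (simp add: field_simps)
  qed
  define M where "M = max (eps / lam0) (4 * C0 ^ 4 * C * (lam0 * c / eps) ^ m)"
  obtain k2 where k2: "\<And>k. k \<ge> k2 \<Longrightarrow> M < W k"
    using assms(15) by (auto simp: filterlim_at_top_dense eventually_sequentially)
  \<comment> \<open>Starting at distance at least \<open>Suc K\<close> leaves the neighbour at
    distance at least \<open>K\<close>, so both ends lie beyond all thresholds.\<close>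
  define K where "K = Max {k1, k2, Suc k0}"
  obtain x where x: "Suc K \<le> r x"
    using graph_dist_unbounded[OF assms(2,4,5)] unfolding r_def by blast
  obtain z where z: "adj E x z" using neighbour_exists by blast
  have rz: "K \<le> r z" using r_adj[OF z] x by simp
  \<comment> \<open>Stated for either orientation of the edge, so that the end with the larger
    \<open>nu\<close> can take the role of \<open>u\<close>.\<close>
  have contra: False if "adj E u v" "K \<le> r u" "K \<le> r v" "nu v \<le> nu u" for u v
    using V_bounded[of u v] k2[of "r u"] that by (auto simp: V_eq M_def K_def)
  show False
    using contra[of x z] contra[of z x] z x rz by (cases "nu z \<le> nu x") (auto simp: adj_commute)
qed

end
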